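(* Let $m$ and $r$ be integers with $2 \le m \le r-1$. Let $G$ be an $r$-regular graph of even order with $\lambda_c(G) \ge mr - m + 1$, and let $M$ be a matching in $G$ with $|M| = m$. If there exist $mr - \left\lceil \frac{r}{2} \right\rceil + 1$ edge-disjoint odd ears of $V(M)$ in $G$, then $M$ extends to a perfect matching of $G$.
   Context: All graphs are finite and simple. $V(M)$ is the set of endvertices of the edges of $M$. A set $F$ of edges of a graph $G$ is a cyclic edge cut if $G-F$ has two components each of which contains a cycle. The cyclic edge-connectivity $\lambda_c(G)$ is the size of a minimum cyclic edge cut of $G$; if $G$ has no cyclic edge cut, $\lambda_c(G)=\infty$. For $U \subseteq V(G)$, an ear of $U$ is either a path having both endvertices but no internal vertices in $U$, or a cycle having exactly one vertex in $U$ (in particular, every edge joining two vertices of $U$ is an ear of $U$). An ear is odd if it contains an odd number of edges. A matching $M$ of $G$ extends to a perfect matching if there is a perfect matching $M^*$ of $G$ with $M \subseteq M^*$. *)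

theory Defs
  imports Complex_Main "HOL-Library.Extended_Nat"
begin

(* A graph is given by its vertex set V and its edge set E of two-element vertex sets. *)

definition simple_graph :: "'a set \<Rightarrow> 'a set set \<Rightarrow> bool" where
  "simple_graph V E \<longleftrightarrow> finite V \<and> (\<forall>e\<in>E. e \<subseteq> V \<and> card e = 2)"

definition regular_graph :: "nat \<Rightarrow> 'a set \<Rightarrow> 'a set set \<Rightarrow> bool" where
  "regular_graph r V E \<longleftrightarrow> simple_graph V E \<and> (\<forall>v\<in>V. card {e \<in> E. v \<in> e} = r)"

(* Walks, and hence paths and cycles, are nonempty lists of vertices. *)

definition walk_edges :: "'a list \<Rightarrow> 'a set set" where
  "walk_edges p = set (map2 (\<lambda>u v. {u, v}) p (tl p))"

definition is_walk :: "'a set \<Rightarrow> 'a set set \<Rightarrow> 'a list \<Rightarrow> bool" where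
  "is_walk V E p \<longleftrightarrow> p \<noteq> [] \<and> set p \<subseteq> V \<and> walk_edges p \<subseteq> E"

definition is_path :: "'a set \<Rightarrow> 'a set set \<Rightarrow> 'a list \<Rightarrow> bool" where
  "is_path V E p \<longleftrightarrow> is_walk V E p \<and> distinct p"

(* The start vertex of a cycle is repeated at the end of the list, so length 4 is a triangle. *)
definition is_cycle :: "'a set \<Rightarrow> 'a set set \<Rightarrow> 'a list \<Rightarrow> bool" where
  "is_cycle V E c \<longleftrightarrow> is_walk V E c \<and> 4 \<le> length c \<and> hd c = last c \<and> distinct (tl c)"

definition graph_components :: "'a set \<Rightarrow> 'a set set \<Rightarrow> 'a set set" where
  "graph_components V E =
     V // {(u, v). \<exists>p. is_walk V E p \<and> hd p = u \<and> last p = v}"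

definition cyclic_edge_cut :: "'a set \<Rightarrow> 'a set set \<Rightarrow> 'a set set \<Rightarrow> bool" where
  "cyclic_edge_cut V E F \<longleftrightarrow> F \<subseteq> E \<and>
     (\<exists>C\<in>graph_components V (E - F). \<exists>D\<in>graph_components V (E - F). C \<noteq> D \<and>
        (\<exists>c. is_cycle V (E - F) c \<and> set c \<subseteq> C) \<and>
        (\<exists>d. is_cycle V (E - F) d \<and> set d \<subseteq> D))"

(* The infimum of the empty set in enat is infinity. *)
definition cyclic_edge_connectivity :: "'a set \<Rightarrow> 'a set set \<Rightarrow> enat" where
  "cyclic_edge_connectivity V E = (INF F\<in>{F. cyclic_edge_cut V E F}. enat (card F))"

definition is_ear :: "'a set \<Rightarrow> 'a set set \<Rightarrow> 'a set \<Rightarrow> 'a list \<Rightarrow> bool" where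
  "is_ear V E U p \<longleftrightarrow>
     (is_path V E p \<and> hd p \<in> U \<and> last p \<in> U \<and> set (butlast (tl p)) \<inter> U = {}) \<or>
     (is_cycle V E p \<and> card (set p \<inter> U) = 1)"

definition odd_ear :: "'a set \<Rightarrow> 'a set set \<Rightarrow> 'a set \<Rightarrow> 'a list \<Rightarrow> bool" where
  "odd_ear V E U p \<longleftrightarrow> is_ear V E U p \<and> odd (card (walk_edges p))"

definition graph_matching :: "'a set set \<Rightarrow> 'a set set \<Rightarrow> bool" where
  "graph_matching E M \<longleftrightarrow> M \<subseteq> E \<and> pairwise disjnt M"

definition perfect_matching :: "'a set \<Rightarrow> 'a set set \<Rightarrow> 'a set set \<Rightarrow> bool" where
  "perfect_matching V E M \<longleftrightarrow> graph_matching E M \<and> \<Union>M = V"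

definition extends_to_perfect_matching :: "'a set \<Rightarrow> 'a set set \<Rightarrow> 'a set set \<Rightarrow> bool" where
  "extends_to_perfect_matching V E M \<longleftrightarrow> (\<exists>N. perfect_matching V E N \<and> M \<subseteq> N)"

end

theory Submission
  imports Defs
begin

text \<open>Let \<open>U = V(M)\<close>. If \<open>G - U\<close> has no perfect matching, Tutte's theorem and parity give a set
  \<open>S\<close> with at least \<open>|S| + 2\<close> odd components of \<open>G - (S \<union> U)\<close>. For a largest such \<open>S\<close>, every
  component is a single vertex or has minimum degree at least 2: otherwise moving a suitable
  vertex into \<open>S\<close> (the neighbour of a leaf, for instance) would give a larger one. Counting the
  edges that leave \<open>T = S \<union> U\<close> shows, by \<open>\<lambda>\<^sub>c(G) \<ge> m(r - 1) + 1\<close>, that at most one component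
  contains a cycle. An odd ear of \<open>U\<close> either uses an edge inside \<open>T\<close>, which removes two from the
  count, or takes two edges at the cyclic component; with \<open>mr - \<lceil>r/2\<rceil> + 1\<close> edge-disjoint odd ears,
  too few edges are left for the components.\<close>

subsection \<open>Hall's marriage theorem\<close>

text \<open>Induction on \<open>card I\<close>. If a proper nonempty \<open>J\<close> is tight, it
  is matched inside its neighbourhood \<open>B\<close> and the other indices outside
  \<open>B\<close>. If none is tight, every proper nonempty subfamily has an element to spare, so
  any \<open>x\<close> can be given to one index and deleted from the other sets.\<close>

lemma hall_marriage:
  fixes N :: "'i \<Rightarrow> 'b set"
  assumes "finite I" and "\<And>i. i \<in> I \<Longrightarrow> finite (N i)"
    and "\<And>J. J \<subseteq> I \<Longrightarrow> card J \<le> card (\<Union>(N ` J))"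
  shows "\<exists>f. inj_on f I \<and> (\<forall>i\<in>I. f i \<in> N i)"
  using assms
proof (induction "card I" arbitrary: I N rule: less_induct)
  case less
  note fin = less.prems(1,2) and hall = less.prems(3)
  show ?case
  proof (cases "\<exists>J. J \<subset> I \<and> J \<noteq> {} \<and> card (\<Union>(N ` J)) = card J")
    case True
    then obtain J where J: "J \<subset> I" "J \<noteq> {}" "card (\<Union>(N ` J)) = card J" by blast
    define B where "B = \<Union>(N ` J)"
    have finJ: "finite J" using J(1) fin(1) finite_subset by blast
    have finB: "finite B" unfolding B_def using finJ J(1) fin(2) by blast
    have "card J < card I" using J(1) fin(1) psubset_card_mono by blast
    then obtain f where f: "inj_on f J" "\<forall>i\<in>J. f i \<in> N i"
      using less.hyps[of J N] J(1) fin hall finJ by (meson psubset_imp_subset subset_trans subsetD)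
    have "card (I - J) < card I"
      using J fin(1) by (metis Diff_subset card_mono finJ card_Diff_subset card_gt_0_iff
          diff_less le_eq_less_or_eq psubset_imp_subset le_less_trans not_less)
    \<comment> \<open>Hall's condition survives outside \<open>B\<close>: it holds for
      \<open>K \<union> J\<close>, and \<open>card B = card J\<close> cancels.\<close>
    moreover have "card K \<le> card (\<Union>((\<lambda>i. N i - B) ` K))" if K: "K \<subseteq> I - J" for K
    proof -
      have finK: "finite K" using K fin(1) finite_subset by blast
      have "card K + card J = card (K \<union> J)"
        using K finK finJ by (subst card_Un_disjoint) auto
      also have "\<dots> \<le> card (\<Union>(N ` (K \<union> J)))" using hall[of "K \<union> J"] K J(1) by blast
      also have "\<Union>(N ` (K \<union> J)) = \<Union>((\<lambda>i. N i - B) ` K) \<union> B" unfolding B_def by auto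
      also have "card \<dots> \<le> card (\<Union>((\<lambda>i. N i - B) ` K)) + card B" by (rule card_Un_le)
      finally show ?thesis using J(3) B_def by simp
    qed
    ultimately obtain g where g: "inj_on g (I - J)" "\<forall>i\<in>I-J. g i \<in> N i - B"
      using less.hyps[of "I - J" "\<lambda>i. N i - B"] fin by auto
    have fB: "f i \<in> B" if "i \<in> J" for i using f(2) that unfolding B_def by blast
    define h where "h = (\<lambda>i. if i \<in> J then f i else g i)"
    have "inj_on h I"
      unfolding inj_on_def h_def using f(1) g fB
      by (smt (verit) Diff_iff inj_on_def)
    moreover have "\<forall>i\<in>I. h i \<in> N i" using f(2) g(2) unfolding h_def by auto
    ultimately show ?thesis by blast
  next
    case False
    show ?thesis
    proof (cases "I = {}")
      case True
      then show ?thesis by simp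
    next
      case False
      then obtain i where i: "i \<in> I" by blast
      have "card {i} \<le> card (N i)" using hall[of "{i}"] i by auto
      then obtain x where x: "x \<in> N i"
        by (metis card.empty card_1_singleton_iff equals0I not_one_le_zero One_nat_def)
      have "card (I - {i}) < card I" using i fin(1) by (meson card_Diff1_less)
      moreover have "card K \<le> card (\<Union>((\<lambda>j. N j - {x}) ` K))" if K: "K \<subseteq> I - {i}" for K
      proof (cases "K = {}")
        case False
        have "K \<subset> I" using K i by blast
        then have "card K < card (\<Union>(N ` K))"
          using \<open>\<not> (\<exists>J. _ J)\<close> False hall[of K] by (metis le_eq_less_or_eq psubset_imp_subset)
        moreover have "\<Union>((\<lambda>j. N j - {x}) ` K) = \<Union>(N ` K) - {x}" by auto
        ultimately show ?thesis using diff_card_le_card_Diff[of "{x}" "\<Union>(N ` K)"] by simp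
      qed simp
      ultimately obtain g where g: "inj_on g (I - {i})" "\<forall>j\<in>I-{i}. g j \<in> N j - {x}"
        using less.hyps[of "I - {i}" "\<lambda>j. N j - {x}"] fin by auto
      have "inj_on (g(i := x)) I"
        unfolding inj_on_def using g by (auto simp: inj_on_def)
      moreover have "\<forall>j\<in>I. (g(i := x)) j \<in> N j" using g(2) x by auto
      ultimately show ?thesis by blast
    qed
  qed
qed

subsection \<open>Components of induced subgraphs\<close>

text \<open>Connectivity is encoded by cuts instead of walks, so that splitting and comparing
  components is pure set reasoning.\<close>

definition connected_on :: "'a set set \<Rightarrow> 'a set \<Rightarrow> bool" where
  "connected_on E C \<longleftrightarrow> (\<forall>A\<subseteq>C. A \<noteq> {} \<longrightarrow> A \<noteq> C \<longrightarrow> (\<exists>a\<in>A. \<exists>b\<in>C - A. {a, b} \<in> E))"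

text \<open>The vertex sets of the components of the subgraph induced on \<open>X\<close>;
  \<open>E\<close> is never restricted, since only pairs inside \<open>X\<close> are tested.\<close>

definition comps :: "'a set set \<Rightarrow> 'a set \<Rightarrow> 'a set set" where
  "comps E X =
     {C. C \<noteq> {} \<and> C \<subseteq> X \<and> connected_on E C \<and> (\<forall>a\<in>C. \<forall>b\<in>X - C. {a, b} \<notin> E)}"

definition odd_comps :: "'a set set \<Rightarrow> 'a set \<Rightarrow> 'a set set" where
  "odd_comps E X = {C \<in> comps E X. odd (card C)}"

lemma connected_onD:
  "\<lbrakk>connected_on E C; A \<subseteq> C; A \<noteq> {}; A \<noteq> C\<rbrakk> \<Longrightarrow> \<exists>a\<in>A. \<exists>b\<in>C - A. {a, b} \<in> E"
  unfolding connected_on_def by blast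

lemma comps_nonempty: "C \<in> comps E X \<Longrightarrow> C \<noteq> {}"
  and comps_subset: "C \<in> comps E X \<Longrightarrow> C \<subseteq> X"
  and comps_connected: "C \<in> comps E X \<Longrightarrow> connected_on E C"
  and comps_no_edge: "\<lbrakk>C \<in> comps E X; a \<in> C; b \<in> X - C\<rbrakk> \<Longrightarrow> {a, b} \<notin> E"
  unfolding comps_def by blast+

lemma finite_comps: "finite X \<Longrightarrow> finite (comps E X)"
  by (rule finite_subset[of _ "Pow X"]) (auto dest: comps_subset)

lemma finite_odd_comps: "finite X \<Longrightarrow> finite (odd_comps E X)"
  by (simp add: odd_comps_def finite_comps)

lemma finite_comp: "\<lbrakk>finite X; C \<in> comps E X\<rbrakk> \<Longrightarrow> finite C"
  by (rule finite_subset[OF comps_subset])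

text \<open>Otherwise connectivity of \<open>D\<close> yields an edge from
  \<open>C \<inter> D\<close> to \<open>D - C\<close>, which leaves the component \<open>C\<close>
  inside \<open>X\<close>.\<close>

lemma connected_subset_comp:
  assumes "C \<in> comps E X" "connected_on E D" "D \<subseteq> X" "C \<inter> D \<noteq> {}"
  shows "D \<subseteq> C"
proof (rule ccontr)
  assume "\<not> D \<subseteq> C"
  then have "\<exists>a\<in>C \<inter> D. \<exists>b\<in>D - C \<inter> D. {a, b} \<in> E"
    using assms by (intro connected_onD) auto
  then show False using comps_no_edge[OF assms(1)] assms(3) by blast
qed

lemma comps_disjoint:
  assumes "C \<in> comps E X" "D \<in> comps E X" "C \<noteq> D"
  shows "C \<inter> D = {}"
  using connected_subset_comp[of C E X D] connected_subset_comp[of D E X C] assms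
    comps_connected comps_subset by (metis Int_commute subset_antisym)

lemma Union_comps:
  assumes "finite X"
  shows "\<Union>(comps E X) = X"
proof
  show "\<Union>(comps E X) \<subseteq> X" using comps_subset by blast
  show "X \<subseteq> \<Union>(comps E X)"
  proof
    fix x assume x: "x \<in> X"
    \<comment> \<open>Sets containing \<open>x\<close> and closed under adjacency in
      \<open>X\<close>. A smallest one is connected: if no edge joined \<open>A\<close> to
      \<open>K - A\<close>, whichever of the two contains \<open>x\<close> would be a smaller closed
      set.\<close>
    define cl where "cl = (\<lambda>K. x \<in> K \<and> K \<subseteq> X \<and> (\<forall>a\<in>K. \<forall>b\<in>X - K. {a, b} \<notin> E))"
    have "cl X" unfolding cl_def using x by auto
    then obtain K where K: "cl K" and min: "\<And>L. cl L \<Longrightarrow> card K \<le> card L"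
      using ex_has_least_nat[of cl X card] by blast
    have finK: "finite K" using K assms finite_subset unfolding cl_def by blast
    have "connected_on E K"
      unfolding connected_on_def
    proof (intro allI impI, rule ccontr)
      fix A assume A: "A \<subseteq> K" "A \<noteq> {}" "A \<noteq> K" and "\<not> (\<exists>a\<in>A. \<exists>b\<in>K - A. {a, b} \<in> E)"
      then have n: "\<And>a b. a \<in> A \<Longrightarrow> b \<in> K - A \<Longrightarrow> {a, b} \<notin> E \<and> {b, a} \<notin> E"
        by (metis insert_commute)
      show False
      proof (cases "x \<in> A")
        case True
        then have "cl A" using K A n unfolding cl_def by blast
        moreover have "card A < card K" using A finK by (simp add: psubset_card_mono psubsetI)
        ultimately show False using min by fastforce
      next
        case False
        then have "cl (K - A)" using K A n unfolding cl_def by blast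
        moreover have "card (K - A) < card K" using A finK by (intro psubset_card_mono) auto
        ultimately show False using min by fastforce
      qed
    qed
    then have "K \<in> comps E X" using K unfolding cl_def comps_def by blast
    then show "x \<in> \<Union>(comps E X)" using K unfolding cl_def by blast
  qed
qed

lemma even_card_odd_comps_iff:
  assumes "finite X"
  shows "even (card (odd_comps E X)) \<longleftrightarrow> even (card X)"
proof -
  have "card X = (\<Sum>C\<in>comps E X. card C)"
    using card_Union_disjoint[of "comps E X"] comps_disjoint comps_subset
      Union_comps[OF assms, of E] assms finite_subset
    by (metis (no_types, lifting) disjnt_def pairwiseI)
  then show ?thesis
    using even_sum_iff[of "comps E X" card] finite_comps[OF assms] unfolding odd_comps_def by simp
qed

lemma even_card_Diff_singleton:
  "\<lbrakk>finite C; v \<in> C\<rbrakk> \<Longrightarrow> even (card (C - {v})) \<longleftrightarrow> odd (card C)"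
  by (metis card.remove even_Suc)

lemma comps_mono_neighbours:
  assumes "C \<in> comps E X" "C \<subseteq> Y" "\<And>a b. a \<in> C \<Longrightarrow> b \<in> Y - C \<Longrightarrow> {a, b} \<notin> E"
  shows "C \<in> comps E Y"
  using assms unfolding comps_def by blast

text \<open>Deleting vertices of one component breaks up that component only.\<close>

lemma comps_Diff:
  assumes "finite X" "C \<in> comps E X" "Y \<subseteq> C"
  shows "comps E (X - Y) = (comps E X - {C}) \<union> comps E (C - Y)"
proof (intro set_eqI iffI)
  fix D assume D: "D \<in> comps E (X - Y)"
  show "D \<in> (comps E X - {C}) \<union> comps E (C - Y)"
  proof (cases "C \<inter> D = {}")
    case True
    have "{a, b} \<notin> E" if "a \<in> D" "b \<in> X - D" for a b
    proof (cases "b \<in> Y")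
      case True
      then show ?thesis using comps_no_edge[OF assms(2), of b a] assms(3) that(1) \<open>C \<inter> D = {}\<close>
          comps_subset[OF D] by (auto simp: insert_commute)
    next
      case False
      then show ?thesis using comps_no_edge[OF D] that by blast
    qed
    then have "D \<in> comps E X"
      using comps_mono_neighbours[OF D] comps_subset[OF D] by blast
    then show ?thesis using True comps_nonempty[OF D] by blast
  next
    case False
    then have "D \<subseteq> C"
      using connected_subset_comp[OF assms(2) comps_connected[OF D]] comps_subset[OF D] by blast
    then have "D \<in> comps E (C - Y)"
      using comps_mono_neighbours[OF D, of "C - Y"] comps_subset[OF D] comps_no_edge[OF D]
        comps_subset[OF assms(2)] by blast
    then show ?thesis by blast
  qed
next
  fix D assume "D \<in> (comps E X - {C}) \<union> comps E (C - Y)"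
  then consider (other) "D \<in> comps E X" "D \<noteq> C" | (inner) "D \<in> comps E (C - Y)" by blast
  then show "D \<in> comps E (X - Y)"
  proof cases
    case other
    then have "C \<inter> D = {}" using comps_disjoint assms(2) by metis
    then show ?thesis
      using comps_mono_neighbours[OF other(1), of "X - Y"] comps_subset[OF other(1)]
        comps_no_edge[OF other(1)] assms(3) by blast
  next
    case inner
    have "{a, b} \<notin> E" if "a \<in> D" "b \<in> X - Y - D" for a b
    proof (cases "b \<in> C")
      case True
      then show ?thesis using comps_no_edge[OF inner] that by blast
    next
      case False
      then show ?thesis using comps_no_edge[OF assms(2)] that comps_subset[OF inner] by blast
    qed
    moreover have "D \<subseteq> X - Y" using comps_subset[OF inner] comps_subset[OF assms(2)] by blast
    ultimately show ?thesis by (intro comps_mono_neighbours[OF inner])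
  qed
qed

text \<open>\<open>C\<close> is traded for the odd components of \<open>C - Y\<close>. The
  conditional records whether \<open>C\<close> itself was counted; it stands on the left to avoid
  truncated subtraction.\<close>

lemma card_odd_comps_Diff:
  assumes "finite X" "C \<in> comps E X" "Y \<subseteq> C"
  shows "card (odd_comps E (X - Y)) + (if odd (card C) then 1 else 0)
       = card (odd_comps E X) + card (odd_comps E (C - Y))"
proof -
  have fin: "finite (odd_comps E X)" "finite (odd_comps E (C - Y))"
    using assms finite_odd_comps comps_subset finite_subset finite_Diff by metis+
  have eq: "odd_comps E (X - Y) = (odd_comps E X - {C}) \<union> odd_comps E (C - Y)"
    using comps_Diff[OF assms] unfolding odd_comps_def by blast
  have "(odd_comps E X - {C}) \<inter> odd_comps E (C - Y) = {}"
  proof -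
    have False if "D \<in> comps E X" "D \<noteq> C" "D \<in> comps E (C - Y)" for D
      using comps_disjoint[OF assms(2) that(1)] that comps_subset[OF that(3)]
        comps_nonempty[OF that(1)] by blast
    then show ?thesis unfolding odd_comps_def by blast
  qed
  then have "card (odd_comps E (X - Y)) = card (odd_comps E X - {C}) + card (odd_comps E (C - Y))"
    unfolding eq using fin by (subst card_Un_disjoint) auto
  moreover have "card (odd_comps E X - {C}) + (if odd (card C) then 1 else 0) = card (odd_comps E X)"
  proof (cases "odd (card C)")
    case True
    then have "C \<in> odd_comps E X" using assms(2) unfolding odd_comps_def by blast
    then show ?thesis using True card.remove[OF fin(1), of C] by simp
  next
    case False
    then have "C \<notin> odd_comps E X" unfolding odd_comps_def by blast
    then show ?thesis using False by simp
  qed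
  ultimately show ?thesis by simp
qed

subsection \<open>Tutte's theorem\<close>

text \<open>Take a largest \<open>S\<close> with equality in Tutte's condition. Maximality makes
  every component of \<open>W - S\<close> odd and, by induction, perfectly matchable after removal
  of any one vertex; Hall's theorem then assigns the components bijectively to the vertices of
  \<open>S\<close>.\<close>

theorem tutte:
  assumes "finite W" "\<And>S. S \<subseteq> W \<Longrightarrow> card (odd_comps E (W - S)) \<le> card S"
  shows "\<exists>N. perfect_matching W E N"
  using assms
proof (induction "card W" arbitrary: W rule: less_induct)
  case less
  note fin = less.prems(1) and tutte = less.prems(2)
  define bar where "bar = (\<lambda>S. S \<subseteq> W \<and> card (odd_comps E (W - S)) = card S)"
  have "bar {}" unfolding bar_def using tutte[of "{}"] by auto
  moreover have "\<forall>S. bar S \<longrightarrow> card S < Suc (card W)"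
    unfolding bar_def using fin by (auto simp: less_Suc_eq_le card_mono)
  ultimately obtain S where S: "bar S" and max: "\<And>S'. bar S' \<Longrightarrow> card S' \<le> card S"
    using ex_has_greatest_nat[of bar "{}" card] by blast
  have finS: "finite S" and SW: "S \<subseteq> W" using S fin finite_subset unfolding bar_def by blast+
  let ?X = "W - S"
  have finX: "finite ?X" using fin by blast
  \<comment> \<open>By maximality \<open>S \<union> Y\<close> is not tight, so Tutte's inequality
    for it is strict; \<open>card_odd_comps_Diff\<close> localises this to \<open>C\<close>.\<close>
  have grow: "card (odd_comps E (C - Y)) + card (odd_comps E ?X)
      < (if odd (card C) then 1 else 0) + card S + card Y"
    if C: "C \<in> comps E ?X" and Y: "Y \<subseteq> C" "Y \<noteq> {}" for C Y
  proof -
    have YX: "Y \<subseteq> ?X" using Y comps_subset[OF C] by blast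
    have finY: "finite Y" using YX finX finite_subset by blast
    have c: "card (S \<union> Y) = card S + card Y"
      using YX finS finY by (subst card_Un_disjoint) auto
    have "\<not> bar (S \<union> Y)" using max[of "S \<union> Y"] c finY Y(2) by (auto simp: card_gt_0_iff)
    moreover have "card (odd_comps E (W - (S \<union> Y))) \<le> card (S \<union> Y)"
      using tutte[of "S \<union> Y"] SW YX by blast
    ultimately have "card (odd_comps E (?X - Y)) < card S + card Y"
      using SW YX c unfolding bar_def by (auto simp: Diff_Diff_Int Diff_eq Int_assoc)
    then show ?thesis using card_odd_comps_Diff[OF finX C Y(1)] by auto
  qed
  have oS: "card (odd_comps E ?X) = card S" using S unfolding bar_def by blast
  have oddC: "odd (card C)" if C: "C \<in> comps E ?X" for C
  proof
    assume ev: "even (card C)"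
    obtain v where v: "v \<in> C" using comps_nonempty[OF C] by blast
    have finC: "finite C" by (rule finite_comp[OF finX C])
    \<comment> \<open>An odd set has an odd component, while \<open>grow\<close> with
      \<open>Y = {v}\<close> leaves room for none when \<open>C\<close> is even.\<close>
    have "odd (card (C - {v}))" using even_card_Diff_singleton[OF finC v] ev by blast
    then have "odd (card (odd_comps E (C - {v})))"
      using even_card_odd_comps_iff[of "C - {v}" E] finC by blast
    then show False using grow[OF C, of "{v}"] v ev oS by (cases "card (odd_comps E (C - {v}))") auto
  qed
  then have all_odd: "odd_comps E ?X = comps E ?X" unfolding odd_comps_def by blast
  have critical: "\<exists>N. perfect_matching (C - {v}) E N" if C: "C \<in> comps E ?X" and v: "v \<in> C" for C v
  proof (rule less.hyps)
    have finC: "finite C" by (rule finite_comp[OF finX C])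
    have CW: "C \<subseteq> W" using comps_subset[OF C] by blast
    show "card (C - {v}) < card W"
      using v CW fin by (meson card_Diff1_less card_mono finC less_le_trans)
    show "finite (C - {v})" using finC by blast
    fix Y assume Y: "Y \<subseteq> C - {v}"
    have finY: "finite Y" by (rule finite_subset[OF Y]) (use finC in blast)
    have "even (card (C - {v}))" using even_card_Diff_singleton[OF finC v] oddC[OF C] by blast
    moreover have "card (C - {v} - Y) = card (C - {v}) - card Y"
      using Y finY by (subst card_Diff_subset) auto
    moreover have "card Y \<le> card (C - {v})" using Y finC by (simp add: card_mono)
    ultimately have par: "even (card (odd_comps E (C - {v} - Y))) \<longleftrightarrow> even (card Y)"
      using even_card_odd_comps_iff[of "C - {v} - Y" E] finC by simp
    have eq: "C - insert v Y = C - {v} - Y" by blast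
    \<comment> \<open>\<open>grow\<close> for \<open>insert v Y\<close> allows at most
      \<open>card Y + 1\<close> odd components, and parity excludes that last value.\<close>
    have "card (odd_comps E (C - {v} - Y)) < 1 + card (insert v Y)"
      using grow[OF C, of "insert v Y"] Y v oS oddC[OF C] unfolding eq by auto
    also have "\<dots> = card Y + 2" using Y finY by (subst card_insert_disjoint) auto
    finally show "card (odd_comps E (C - {v} - Y)) \<le> card Y"
      using par by (cases "card (odd_comps E (C - {v} - Y)) = Suc (card Y)") auto
  qed
  define nb where "nb = (\<lambda>C. {s \<in> S. \<exists>c\<in>C. {c, s} \<in> E})"
  have "\<exists>f. inj_on f (comps E ?X) \<and> (\<forall>C\<in>comps E ?X. f C \<in> nb C)"
  proof (rule hall_marriage)
    show "finite (comps E ?X)" using finite_comps[OF finX] .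
    show "finite (nb C)" for C unfolding nb_def using finS by auto
    fix J assume J: "J \<subseteq> comps E ?X"
    let ?T = "\<Union>(nb ` J)"
    have TS: "?T \<subseteq> S" unfolding nb_def by blast
    \<comment> \<open>Components in \<open>J\<close> have all their neighbours from \<open>S\<close>
      in \<open>?T\<close>, so they remain components when only \<open>?T\<close> is deleted;
      Tutte's condition for \<open>?T\<close> is then Hall's condition for \<open>J\<close>.\<close>
    have "J \<subseteq> odd_comps E (W - ?T)"
    proof
      fix C assume CJ: "C \<in> J"
      then have C: "C \<in> comps E ?X" using J by blast
      have "C \<in> comps E (W - ?T)"
      proof (rule comps_mono_neighbours[OF C])
        show "C \<subseteq> W - ?T" using comps_subset[OF C] TS by blast
        fix a b assume "a \<in> C" "b \<in> W - ?T - C"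
        then show "{a, b} \<notin> E"
          using comps_no_edge[OF C, of a b] CJ unfolding nb_def by blast
      qed
      then show "C \<in> odd_comps E (W - ?T)" using oddC[OF C] unfolding odd_comps_def by blast
    qed
    then have "card J \<le> card (odd_comps E (W - ?T))"
      using fin by (intro card_mono finite_odd_comps) auto
    also have "\<dots> \<le> card ?T" using tutte[of ?T] TS SW by blast
    finally show "card J \<le> card ?T" .
  qed
  then obtain f where f: "inj_on f (comps E ?X)" "\<And>C. C \<in> comps E ?X \<Longrightarrow> f C \<in> nb C" by blast
  \<comment> \<open>There are exactly \<open>card S\<close> components, so the injection
    \<open>f\<close> is onto \<open>S\<close>.\<close>
  have fS: "f ` comps E ?X = S"
    using f oS all_odd finS card_image[OF f(1)] unfolding nb_def
    by (intro card_subset_eq) auto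
  have "\<forall>C\<in>comps E ?X. \<exists>c. c \<in> C \<and> {c, f C} \<in> E" using f(2) unfolding nb_def by blast
  then obtain g where g: "\<And>C. C \<in> comps E ?X \<Longrightarrow> g C \<in> C \<and> {g C, f C} \<in> E" by metis
  have "\<exists>N. perfect_matching (C - {g C}) E N" if "C \<in> comps E ?X" for C
    using critical[OF that] g[OF that] by blast
  then obtain h where h: "\<And>C. C \<in> comps E ?X \<Longrightarrow> perfect_matching (C - {g C}) E (h C)"
    by metis
  \<comment> \<open>The edge from \<open>g C\<close> to \<open>f C\<close> together with a perfect
    matching of \<open>C - {g C}\<close> covers exactly \<open>C\<close> and
    \<open>f C\<close>.\<close>
  define K where "K = (\<lambda>C. insert {g C, f C} (h C))"
  have UK: "\<Union>(K C) = insert (f C) C" if "C \<in> comps E ?X" for C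
    using h[OF that] g[OF that] unfolding K_def perfect_matching_def by auto
  have pwK: "pairwise disjnt (K C)" if C: "C \<in> comps E ?X" for C
  proof -
    have "f C \<notin> C" using f(2)[OF C] comps_subset[OF C] unfolding nb_def by blast
    then have "disjnt {g C, f C} e" if "e \<in> h C" for e
      using h[OF C] that unfolding perfect_matching_def disjnt_def by blast
    then show ?thesis
      using h[OF C] unfolding K_def perfect_matching_def graph_matching_def pairwise_insert
      by (auto simp: disjnt_sym)
  qed
  have dis: "insert (f C) C \<inter> insert (f D) D = {}"
    if "C \<in> comps E ?X" "D \<in> comps E ?X" "C \<noteq> D" for C D
  proof -
    have "f C \<noteq> f D" using that f(1) by (meson inj_onD)
    then show ?thesis
      using comps_disjoint[OF that] f(2) that(1,2) comps_subset unfolding nb_def by blast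
  qed
  have "perfect_matching W E (\<Union>(K ` comps E ?X))"
    unfolding perfect_matching_def graph_matching_def
  proof (intro conjI)
    show "\<Union>(K ` comps E ?X) \<subseteq> E"
      using h g unfolding K_def perfect_matching_def graph_matching_def by blast
    show "pairwise disjnt (\<Union>(K ` comps E ?X))"
    proof (rule pairwiseI)
      fix e e' assume "e \<in> \<Union>(K ` comps E ?X)" "e' \<in> \<Union>(K ` comps E ?X)" "e \<noteq> e'"
      then obtain C D where CD: "C \<in> comps E ?X" "D \<in> comps E ?X" "e \<in> K C" "e' \<in> K D" by blast
      show "disjnt e e'"
      proof (cases "C = D")
        case True
        then show ?thesis using pwK CD \<open>e \<noteq> e'\<close> by (meson pairwiseD)
      next
        case False
        then show ?thesis using dis[of C D] UK CD unfolding disjnt_def by blast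
      qed
    qed
    have "\<Union>(\<Union>(K ` comps E ?X)) = (\<Union>C\<in>comps E ?X. insert (f C) C)" using UK by blast
    also have "\<dots> = f ` comps E ?X \<union> \<Union>(comps E ?X)" by blast
    also have "\<dots> = W" using fS Union_comps[OF finX] SW by blast
    finally show "\<Union>(\<Union>(K ` comps E ?X)) = W" .
  qed
  then show ?case by blast
qed

text \<open>Parity raises a surplus of one odd component to two. For a largest such
  \<open>S\<close>, all components \<open>C\<close> are odd and \<open>C - {u}\<close> has no odd
  component for any \<open>u\<close> in \<open>C\<close>. This rules out a vertex with only one
  neighbour in \<open>C\<close>.\<close>

lemma ex_critical_barrier:
  assumes "finite W" "even (card W)" "\<nexists>N. perfect_matching W E N"
  shows "\<exists>S\<subseteq>W. card S + 2 \<le> card (comps E (W - S)) \<and>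
    (\<forall>C\<in>comps E (W - S). is_singleton C \<or>
      (\<forall>v\<in>C. \<exists>a\<in>C - {v}. \<exists>b\<in>C - {v}. a \<noteq> b \<and> {v, a} \<in> E \<and> {v, b} \<in> E))"
proof -
  define bar where "bar = (\<lambda>S. S \<subseteq> W \<and> card S + 2 \<le> card (odd_comps E (W - S)))"
  obtain S0 where S0: "S0 \<subseteq> W" "card S0 < card (odd_comps E (W - S0))"
    using tutte[OF assms(1)] assms(3) by (meson not_le)
  have "card (W - S0) + card S0 = card W"
    using S0(1) assms(1) by (metis card_Diff_subset card_mono finite_subset le_add_diff_inverse2)
  then have "even (card (odd_comps E (W - S0))) \<longleftrightarrow> even (card S0)"
    using even_card_odd_comps_iff[of "W - S0" E] assms(1,2) by (metis even_add finite_Diff)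
  then have "bar S0" unfolding bar_def using S0
    by (cases "card (odd_comps E (W - S0)) = Suc (card S0)") auto
  moreover have "\<forall>S. bar S \<longrightarrow> card S < Suc (card W)"
    unfolding bar_def using assms(1) by (auto simp: less_Suc_eq_le card_mono)
  ultimately obtain S where S: "bar S" and max: "\<And>S'. bar S' \<Longrightarrow> card S' \<le> card S"
    using ex_has_greatest_nat[of bar S0 card] by blast
  have SW: "S \<subseteq> W" using S unfolding bar_def by blast
  have finS: "finite S" by (rule finite_subset[OF SW assms(1)])
  let ?X = "W - S"
  have finX: "finite ?X" using assms(1) by blast
  have grow: "card (odd_comps E (C - {u})) \<le> (if odd (card C) then 1 else 0)"
    if C: "C \<in> comps E ?X" and u: "u \<in> C" for C u
  proof -
    have uX: "u \<in> ?X" using u comps_subset[OF C] by blast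
    have c: "card (insert u S) = Suc (card S)" using uX finS by auto
    have "\<not> bar (insert u S)" using max[of "insert u S"] c by auto
    moreover have "W - insert u S = ?X - {u}" by blast
    ultimately have "card (odd_comps E (?X - {u})) < card S + 3"
      using SW uX c unfolding bar_def by auto
    moreover have "card S + 2 \<le> card (odd_comps E ?X)" using S unfolding bar_def by blast
    ultimately show ?thesis using card_odd_comps_Diff[OF finX C, of "{u}"] u by auto
  qed
  have oddC: "odd (card C)" if C: "C \<in> comps E ?X" for C
  proof
    assume ev: "even (card C)"
    obtain v where v: "v \<in> C" using comps_nonempty[OF C] by blast
    have finC: "finite C" by (rule finite_comp[OF finX C])
    have "odd (card (odd_comps E (C - {v})))"
      using even_card_odd_comps_iff[of "C - {v}" E] even_card_Diff_singleton[OF finC v] ev finC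
      by blast
    then show False using grow[OF C v] ev by auto
  qed
  then have all_odd: "odd_comps E ?X = comps E ?X" unfolding odd_comps_def by blast
  have "is_singleton C \<or>
      (\<forall>v\<in>C. \<exists>a\<in>C - {v}. \<exists>b\<in>C - {v}. a \<noteq> b \<and> {v, a} \<in> E \<and> {v, b} \<in> E)"
    if C: "C \<in> comps E ?X" for C
  proof (rule disjCI)
    assume ns: "\<not> (\<forall>v\<in>C. \<exists>a\<in>C - {v}. \<exists>b\<in>C - {v}. a \<noteq> b \<and> {v, a} \<in> E \<and> {v, b} \<in> E)"
    show "is_singleton C"
    proof (rule ccontr)
      assume nsing: "\<not> is_singleton C"
      obtain v where v: "v \<in> C"
        and n: "\<And>a b. \<lbrakk>a \<in> C - {v}; b \<in> C - {v}; {v, a} \<in> E; {v, b} \<in> E\<rbrakk> \<Longrightarrow> a = b"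
        using ns by blast
      have "{v} \<noteq> C" using nsing unfolding is_singleton_def by blast
      then obtain u where u: "u \<in> C - {v}" "{v, u} \<in> E"
        using connected_onD[OF comps_connected[OF C], of "{v}"] v by blast
      have "connected_on E {v}" unfolding connected_on_def by blast
      \<comment> \<open>\<open>u\<close> is the only neighbour of \<open>v\<close> in
        \<open>C\<close>, so deleting \<open>u\<close> isolates \<open>v\<close> and creates an odd
        component.\<close>
      then have "{v} \<in> comps E (C - {u})" unfolding comps_def using v u n by blast
      then have "{v} \<in> odd_comps E (C - {u})" unfolding odd_comps_def by simp
      moreover have finC: "finite C" by (rule finite_comp[OF finX C])
      ultimately have "card (odd_comps E (C - {u})) \<noteq> 0"
        using finite_odd_comps[of "C - {u}" E] by auto
      moreover have "even (card (odd_comps E (C - {u})))"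
        using even_card_odd_comps_iff[of "C - {u}" E] even_card_Diff_singleton[OF finC] oddC[OF C]
          finC u(1) by blast
      moreover have "card (odd_comps E (C - {u})) \<le> 1"
        using grow[OF C, of u] u(1) oddC[OF C] by simp
      ultimately show False by (cases "card (odd_comps E (C - {u})) = 1") auto
    qed
  qed
  then show ?thesis using S all_odd SW unfolding bar_def by (intro exI[of _ S]) simp
qed

subsection \<open>Walks, cycles and cyclic edge cuts\<close>

lemma walk_edges_simps [simp]:
  "walk_edges [] = {}" "walk_edges [x] = {}"
  "walk_edges (x # y # p) = insert {x, y} (walk_edges (y # p))"
  unfolding walk_edges_def by auto

lemma walk_edges_append:
  "walk_edges (xs @ v # ys) = walk_edges (xs @ [v]) \<union> walk_edges (v # ys)"
proof (induction xs)
  case (Cons x xs)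
  then show ?case by (cases xs) auto
qed simp

lemma walk_edges_conv_nth:
  "walk_edges p = (\<lambda>i. {p ! i, p ! Suc i}) ` {..<length p - 1}"
  unfolding walk_edges_def by (force simp: set_conv_nth nth_tl image_iff)

lemma walk_edges_subset: "e \<in> walk_edges p \<Longrightarrow> e \<subseteq> set p"
  unfolding walk_edges_conv_nth by (auto simp: less_diff_conv)

lemma is_cycle_mono: "\<lbrakk>is_cycle V E c; set c \<subseteq> V'; walk_edges c \<subseteq> E'\<rbrakk> \<Longrightarrow> is_cycle V' E' c"
  unfolding is_cycle_def is_walk_def by blast

text \<open>All neighbours of the first vertex of a longest path lie on the path; with two of them,
  one closes a cycle.\<close>

lemma ex_cycle_of_min_degree:
  assumes "finite C" "C \<noteq> {}"
    and deg: "\<And>v. v \<in> C \<Longrightarrow> \<exists>a\<in>C - {v}. \<exists>b\<in>C - {v}. a \<noteq> b \<and> {v, a} \<in> E \<and> {v, b} \<in> E"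
  shows "\<exists>c. is_cycle C E c"
proof -
  obtain v where "v \<in> C" using assms(2) by blast
  then have "is_path C E [v]" unfolding is_path_def is_walk_def by simp
  moreover have "\<forall>p. is_path C E p \<longrightarrow> length p < Suc (card C)"
    unfolding is_path_def is_walk_def
    by (metis assms(1) card_mono distinct_card less_Suc_eq_le)
  ultimately obtain p where p: "is_path C E p"
    and max: "\<And>q. is_path C E q \<Longrightarrow> length q \<le> length p"
    using ex_has_greatest_nat[of "is_path C E" "[v]" length] by blast
  obtain x ps where xps: "p = x # ps"
    using p unfolding is_path_def is_walk_def by (cases p) auto
  have x: "x \<in> C" using p xps unfolding is_path_def is_walk_def by simp
  have nbr: "a \<in> set ps" if "a \<in> C - {x}" "{x, a} \<in> E" for a
  proof (rule ccontr)
    assume "a \<notin> set ps"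
    then have "is_path C E (a # p)"
      using p that unfolding xps is_path_def is_walk_def by (auto simp: insert_commute)
    then show False using max[of "a # p"] by simp
  qed
  obtain a b where ab: "a \<in> C - {x}" "b \<in> C - {x}" "a \<noteq> b" "{x, a} \<in> E" "{x, b} \<in> E"
    using deg[OF x] by blast
  \<comment> \<open>Of two neighbours of \<open>x\<close> at least one is not its successor on the
    path. \<open>as \<noteq> []\<close> says so for \<open>z\<close> and gives the closed list the
    required length 4.\<close>
  obtain as z bs where ps: "ps = as @ z # bs" "as \<noteq> []" "{x, z} \<in> E"
  proof -
    obtain as bs where s: "ps = as @ a # bs" using split_list[OF nbr[OF ab(1,4)]] by blast
    show ?thesis
    proof (cases "as = []")
      case True
      then have "b \<in> set bs" using nbr[OF ab(2,5)] ab(3) s by auto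
      then obtain cs ds where "bs = cs @ b # ds" using split_list by fast
      then show ?thesis using that[of "a # cs" b ds] s True ab by simp
    next
      case False
      then show ?thesis using that[of as a bs] s ab by simp
    qed
  qed
  have e: "walk_edges p = walk_edges ((x # as) @ [z]) \<union> walk_edges (z # bs)"
    unfolding xps ps(1) using walk_edges_append[of "x # as" z bs] by simp
  have "walk_edges (x # as @ [z, x]) = walk_edges ((x # as) @ [z]) \<union> {{z, x}}"
    using walk_edges_append[of "x # as" z "[x]"] by simp
  then have "walk_edges (x # as @ [z, x]) \<subseteq> E"
    using e p ps(3) unfolding is_path_def is_walk_def by (auto simp: insert_commute)
  then have "is_cycle C E (x # as @ [z, x])"
    using p ps(2) unfolding is_cycle_def is_walk_def is_path_def xps ps(1)
    by (cases as) auto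
  then show ?thesis by blast
qed

text \<open>For two-element edges this is the boundary of \<open>X\<close>: the edges with exactly
  one end in \<open>X\<close>.\<close>

definition edge_cut :: "'a set set \<Rightarrow> 'a set \<Rightarrow> 'a set set" where
  "edge_cut E X = {e \<in> E. e \<inter> X \<noteq> {} \<and> \<not> e \<subseteq> X}"

lemma walk_avoiding_edge_cut:
  assumes "is_walk V (E - edge_cut E C) p" "hd p \<in> C"
  shows "set p \<subseteq> C"
proof -
  have "\<lbrakk>p \<noteq> []; walk_edges p \<subseteq> E - edge_cut E C; hd p \<in> C\<rbrakk> \<Longrightarrow> set p \<subseteq> C"
  proof (induction p rule: induct_list012)
    case (3 x y zs)
    then have "y \<in> C" unfolding edge_cut_def by auto
    then show ?case using 3 by simp
  qed auto
  then show ?thesis using assms unfolding is_walk_def by blast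
qed

text \<open>Both cycles avoid the boundary of \<open>C\<close>, so they survive its removal, and no
  remaining walk leads from \<open>C\<close> to \<open>D\<close>.\<close>

lemma cyclic_edge_cut_edge_cut:
  assumes "C \<subseteq> V" "D \<subseteq> V" "C \<inter> D = {}" "is_cycle C E c" "is_cycle D E d"
  shows "cyclic_edge_cut V E (edge_cut E C)"
proof -
  let ?E = "E - edge_cut E C"
  define R where "R = {(u, v). \<exists>p. is_walk V ?E p \<and> hd p = u \<and> last p = v}"
  have sets: "set c \<subseteq> C" "set d \<subseteq> D" "c \<noteq> []" "d \<noteq> []" "walk_edges c \<subseteq> E" "walk_edges d \<subseteq> E"
    using assms(4,5) unfolding is_cycle_def is_walk_def by auto
  have cyc: "is_cycle V ?E c" "is_cycle V ?E d"
  proof -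
    have "e \<subseteq> C" if "e \<in> walk_edges c" for e
      using walk_edges_subset[OF that] sets(1) by blast
    then have "walk_edges c \<subseteq> ?E" using sets(5) unfolding edge_cut_def by blast
    moreover have "e \<inter> C = {}" if "e \<in> walk_edges d" for e
      using walk_edges_subset[OF that] sets(2) assms(3) by blast
    then have "walk_edges d \<subseteq> ?E" using sets(6) unfolding edge_cut_def by blast
    ultimately show "is_cycle V ?E c" "is_cycle V ?E d"
      using is_cycle_mono[OF assms(4), of V ?E] is_cycle_mono[OF assms(5), of V ?E]
        order_trans[OF sets(1) assms(1)] order_trans[OF sets(2) assms(2)] by auto
  qed
  have comp: "R `` {hd q} \<in> graph_components V ?E" "set q \<subseteq> R `` {hd q}"
    if q: "is_cycle V ?E q" for q
  proof -
    have w: "is_walk V ?E q" using q unfolding is_cycle_def by blast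
    then have "hd q \<in> V" unfolding is_walk_def by (metis hd_in_set subsetD)
    then show "R `` {hd q} \<in> graph_components V ?E"
      unfolding graph_components_def R_def by (rule quotientI)
    show "set q \<subseteq> R `` {hd q}"
    proof
      fix v assume "v \<in> set q"
      then obtain as bs where s: "q = as @ v # bs" using split_list by fast
      have "is_walk V ?E (as @ [v])"
        using w walk_edges_append[of as v bs] unfolding is_walk_def s by auto
      moreover have "hd (as @ [v]) = hd q" unfolding s by (cases as) auto
      ultimately have "(hd q, v) \<in> R" unfolding R_def by (auto intro!: exI[of _ "as @ [v]"])
      then show "v \<in> R `` {hd q}" by blast
    qed
  qed
  have "R `` {hd c} \<subseteq> C"
  proof
    fix v assume "v \<in> R `` {hd c}"
    then obtain p where p: "is_walk V ?E p" "hd p = hd c" "last p = v"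
      unfolding R_def by blast
    then have "set p \<subseteq> C"
      using walk_avoiding_edge_cut[OF p(1)] sets(1,3) by (metis hd_in_set subsetD)
    then show "v \<in> C" using p unfolding is_walk_def by (metis last_in_set subsetD)
  qed
  moreover have "hd d \<in> R `` {hd d}" "hd d \<notin> C"
    using comp(2)[OF cyc(2)] sets(2,4) assms(3) by (meson hd_in_set subsetD disjoint_iff)+
  ultimately have ne: "R `` {hd c} \<noteq> R `` {hd d}" by blast
  have "edge_cut E C \<subseteq> E" unfolding edge_cut_def by blast
  then show ?thesis
    unfolding cyclic_edge_cut_def using comp[OF cyc(1)] comp[OF cyc(2)] cyc ne by metis
qed

subsection \<open>Odd ears\<close>

text \<open>No edge is repeated. This covers paths and closed cycle lists alike and makes the number
  of edges \<open>length p - 1\<close>.\<close>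

definition is_trail :: "'a list \<Rightarrow> bool" where
  "is_trail p \<longleftrightarrow> inj_on (\<lambda>i. {p ! i, p ! Suc i}) {..<length p - 1}"

lemma card_walk_edges: "is_trail p \<Longrightarrow> card (walk_edges p) = length p - 1"
  unfolding is_trail_def walk_edges_conv_nth by (simp add: card_image)

lemma is_trail_distinct:
  assumes "distinct p"
  shows "is_trail p"
  unfolding is_trail_def
proof (rule inj_onI)
  fix i j assume "i \<in> {..<length p - 1}" "j \<in> {..<length p - 1}"
    "{p ! i, p ! Suc i} = {p ! j, p ! Suc j}"
  then show "i = j" using assms by (auto simp: doubleton_eq_iff nth_eq_iff_index_eq less_diff_conv)
qed

lemma is_trail_cycle:
  assumes "4 \<le> length c" "hd c = last c" "distinct (tl c)"
  shows "is_trail c"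
proof -
  have nz: "c \<noteq> []" using assms(1) by auto
  have eqD: "i = j" if "c ! i = c ! j" "0 < i" "0 < j" "i < length c" "j < length c" for i j
  proof -
    have l: "i - 1 < length (tl c)" "j - 1 < length (tl c)" using that by auto
    have "tl c ! (i - 1) = tl c ! (j - 1)" using that l by (simp add: nth_tl)
    then have "i - 1 = j - 1" using nth_eq_iff_index_eq[OF assms(3) l] by blast
    then show ?thesis using that by linarith
  qed
  have c0: "c ! 0 = c ! (length c - 1)" using assms(2) nz by (simp add: hd_conv_nth last_conv_nth)
  \<comment> \<open>Two equal edges at positions \<open>i < j\<close> must be traversed in opposite
    directions, hence consecutively, with \<open>c ! i\<close> equal to
    \<open>c ! Suc (Suc i)\<close>. Only the repeated start vertex could permit this, and then the
    list would have length 3.\<close>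
  have *: False if "i < j" "j < length c - 1" "{c ! i, c ! Suc i} = {c ! j, c ! Suc j}" for i j
  proof -
    have sj: "Suc j < length c" using that(2) by simp
    have "c ! Suc i \<noteq> c ! Suc j" using eqD[of "Suc i" "Suc j"] that(1) sj by auto
    then have "c ! Suc i = c ! j" "c ! i = c ! Suc j" using that(3) by (auto simp: doubleton_eq_iff)
    then have "j = Suc i" "c ! i = c ! Suc (Suc i)" using eqD[of "Suc i" j] that(1) sj by auto
    show False
    proof (cases "i = 0")
      case True
      then have "c ! (length c - 1) = c ! 2" using c0 \<open>c ! i = c ! Suc (Suc i)\<close> by (simp add: numeral_2_eq_2)
      then have "length c - 1 = 2" using eqD[of "length c - 1" 2] assms(1) by auto
      then show False using assms(1) by linarith
    next
      case False
      then have "i = Suc (Suc i)"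
        using eqD[of i "Suc (Suc i)"] \<open>c ! i = c ! Suc (Suc i)\<close> \<open>j = Suc i\<close> sj by auto
      then show False by simp
    qed
  qed
  show ?thesis unfolding is_trail_def
  proof (rule inj_onI)
    fix i j assume "i \<in> {..<length c - 1}" "j \<in> {..<length c - 1}"
      "{c ! i, c ! Suc i} = {c ! j, c ! Suc j}"
    then show "i = j" using *[of i j] *[of j i] by (cases i j rule: linorder_cases) auto
  qed
qed

text \<open>The list of a cyclic ear may start outside \<open>U\<close>; rotating it puts its vertex
  in \<open>U\<close> at both ends.\<close>

lemma rotate_cycle:
  assumes "is_cycle V E c" "u \<in> set c"
  shows "\<exists>c'. is_cycle V E c' \<and> walk_edges c' = walk_edges c \<and> hd c' = u"
proof -
  obtain as bs where s: "c = as @ u # bs" using split_list[OF assms(2)] by blast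
  show ?thesis
  proof (cases "as = [] \<or> bs = []")
    case True
    then have "hd c = u" using assms(1) s unfolding is_cycle_def by auto
    then show ?thesis using assms(1) by blast
  next
    case False
    then obtain x as' where as: "as = x # as'" by (cases as) auto
    obtain bs' y where bs: "bs = bs' @ [y]" using False by (cases bs rule: rev_cases) auto
    have y: "y = x" using assms(1) unfolding is_cycle_def s as bs by simp
    let ?c = "u # bs' @ x # as' @ [u]"
    have "walk_edges ?c = walk_edges c"
      using walk_edges_append[of "u # bs'" x "as' @ [u]"] walk_edges_append[of "x # as'" u "bs' @ [x]"]
      unfolding s as bs y by auto
    moreover have "set ?c = set c" unfolding s as bs y by auto
    ultimately have "is_cycle V E ?c"
      using assms(1) unfolding is_cycle_def is_walk_def s as bs y by auto
    then show ?thesis using \<open>walk_edges ?c = walk_edges c\<close> by auto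
  qed
qed

text \<open>Brings both kinds of ear into one form for the crossing argument. An odd number of edges
  means a list of even length.\<close>

lemma odd_ear_trail:
  assumes "odd_ear V E U p"
  obtains q where "is_walk V E q" "is_trail q" "walk_edges q = walk_edges p"
    "hd q \<in> U" "last q \<in> U" "even (length q)"
proof -
  have "\<exists>q. is_walk V E q \<and> is_trail q \<and> walk_edges q = walk_edges p \<and> hd q \<in> U \<and> last q \<in> U"
  proof (cases "is_path V E p \<and> hd p \<in> U \<and> last p \<in> U")
    case True
    then show ?thesis using is_trail_distinct[of p] unfolding is_path_def by blast
  next
    case False
    then have c: "is_cycle V E p" "card (set p \<inter> U) = 1"
      using assms unfolding odd_ear_def is_ear_def by auto
    then obtain u where "u \<in> set p" "u \<in> U" by (metis Int_iff card_1_singletonE insertI1)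
    then obtain c' where "is_cycle V E c'" "walk_edges c' = walk_edges p" "hd c' \<in> U"
      using rotate_cycle[OF c(1)] by metis
    then show ?thesis using is_trail_cycle[of c'] unfolding is_cycle_def by metis
  qed
  then obtain q where q: "is_walk V E q" "is_trail q" "walk_edges q = walk_edges p"
    "hd q \<in> U" "last q \<in> U" by blast
  have "odd (length q - 1)" using assms card_walk_edges[OF q(2)] q(3) unfolding odd_ear_def by simp
  then have "even (length q)" by (cases "length q") auto
  then show ?thesis using that q by blast
qed

text \<open>Away from \<open>C\<close> a trail without an edge inside \<open>T\<close> alternates between \<open>T\<close> and the
  independent set \<open>I\<close>, so an odd one has to visit \<open>C\<close>.\<close>

lemma odd_trail_crosses_edge_cut:
  assumes "is_walk V E q" "is_trail q" "hd q \<in> T" "last q \<in> T" "even (length q)"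
    and "V \<subseteq> T \<union> I \<union> C" "T \<inter> C = {}"
    and indep: "\<And>a b. \<lbrakk>a \<in> I; b \<notin> T\<rbrakk> \<Longrightarrow> {a, b} \<notin> E"
    and noT: "\<And>e. e \<in> walk_edges q \<Longrightarrow> \<not> e \<subseteq> T"
  shows "2 \<le> card (walk_edges q \<inter> edge_cut E C)"
proof -
  let ?n = "length q" and ?e = "\<lambda>i. {q ! i, q ! Suc i}"
  have nz: "q \<noteq> []" and sq: "set q \<subseteq> V" and qE: "walk_edges q \<subseteq> E"
    using assms(1) unfolding is_walk_def by auto
  have e: "?e i \<in> walk_edges q" if "Suc i < ?n" for i
    unfolding walk_edges_conv_nth using that by auto
  have q0: "q ! 0 \<in> T" "q ! (?n - 1) \<in> T"
    using assms(3,4) nz by (auto simp: hd_conv_nth last_conv_nth)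
  have "\<exists>k<?n. q ! k \<in> C"
  proof (rule ccontr)
    assume "\<not> (\<exists>k<?n. q ! k \<in> C)"
    then have I: "q ! k \<in> T \<or> q ! k \<in> I" if "k < ?n" for k
      using that sq assms(6) nth_mem[OF that] by blast
    have "q ! k \<in> T \<longleftrightarrow> even k" if "k < ?n" for k
      using that
    proof (induction k)
      case (Suc k)
      then show ?case
        using noT[OF e, of k] I[of k] indep[of "q ! k" "q ! Suc k"] e[of k] qE by auto
    qed (simp add: q0)
    then have "even (?n - 1)" using q0(2) nz by simp
    then show False using assms(5) nz by (cases ?n) auto
  qed
  then obtain k where k: "k < ?n" "q ! k \<in> C" by blast
  \<comment> \<open>The edge at \<open>i\<close> is the first entry into \<open>C\<close>, and the
    one at \<open>k + l\<close> is the first exit after position \<open>k\<close>. Their positions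
    differ, so in a trail the edges differ.\<close>
  obtain i where i: "i < k" "q ! i \<notin> C" "q ! Suc i \<in> C"
    using ex_least_nat_less[of "\<lambda>i. q ! i \<in> C" k] k q0(1) assms(7) by blast
  have "\<exists>l<?n - 1 - k. (\<forall>l'\<le>l. \<not> q ! (k + l') \<notin> C) \<and> q ! (k + Suc l) \<notin> C"
    using ex_least_nat_less[of "\<lambda>l. q ! (k + l) \<notin> C" "?n - 1 - k"] k q0(2) assms(7) by auto
  then obtain l where l: "l < ?n - 1 - k" "q ! (k + l) \<in> C" "q ! Suc (k + l) \<notin> C" by auto
  have "?e i \<noteq> ?e (k + l)"
  proof
    assume eq: "?e i = ?e (k + l)"
    have "i \<in> {..<?n - 1}" "k + l \<in> {..<?n - 1}" using i(1) l(1) by auto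
    then have "i = k + l" using inj_onD[OF assms(2)[unfolded is_trail_def] eq] by blast
    then show False using i(1) by simp
  qed
  moreover have "{?e i, ?e (k + l)} \<subseteq> walk_edges q \<inter> edge_cut E C"
    using e[of i] e[of "k + l"] i l k qE unfolding edge_cut_def by auto
  moreover have "finite (walk_edges q)" unfolding walk_edges_def by simp
  ultimately show ?thesis
    using card_mono[of "walk_edges q \<inter> edge_cut E C" "{?e i, ?e (k + l)}"] by simp
qed

text \<open>Double counting of the degrees over \<open>T\<close>: an edge inside \<open>T\<close>
  counts twice, a boundary edge once.\<close>

lemma regular_graph_handshake:
  assumes "regular_graph r V E" "T \<subseteq> V"
  shows "r * card T = 2 * card {e \<in> E. e \<subseteq> T} + card (edge_cut E T)"
proof -
  have finV: "finite V" and E: "\<And>e. e \<in> E \<Longrightarrow> e \<subseteq> V \<and> card e = 2"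
    using assms(1) unfolding regular_graph_def simple_graph_def by auto
  have finE: "finite E" by (rule finite_subset[of _ "Pow V"]) (use E finV in auto)
  have finT: "finite T" by (rule finite_subset[OF assms(2) finV])
  have deg: "card {e \<in> E. v \<in> e} = r" if "v \<in> T" for v
    using assms that unfolding regular_graph_def by auto
  have "r * card T = (\<Sum>v\<in>T. card {e \<in> E. v \<in> e})" by (simp add: deg)
  also have "\<dots> = (\<Sum>v\<in>T. \<Sum>e\<in>E. if v \<in> e then 1 else 0)"
    using finE by (intro sum.cong) (auto simp: sum.If_cases Int_def)
  also have "\<dots> = (\<Sum>e\<in>E. \<Sum>v\<in>T. if v \<in> e then 1 else 0)" by (rule sum.swap)
  also have "\<dots> = (\<Sum>e\<in>E. (if e \<subseteq> T then 2 else 0 :: nat) + (if e \<in> edge_cut E T then 1 else 0))"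
  proof (rule sum.cong)
    fix e assume e: "e \<in> E"
    then obtain a b where ab: "e = {a, b}" "a \<noteq> b" using E by (meson card_2_iff)
    have "(\<Sum>v\<in>T. if v \<in> e then 1 else 0) = card (T \<inter> e)"
      using finT by (simp add: sum.If_cases)
    also have "\<dots> = (if e \<subseteq> T then 2 else 0) + (if e \<in> edge_cut E T then 1 else 0)"
      using ab e unfolding edge_cut_def by (auto simp: Int_insert_right)
    finally show "(\<Sum>v\<in>T. if v \<in> e then 1 else 0) =
      (if e \<subseteq> T then 2 else 0 :: nat) + (if e \<in> edge_cut E T then 1 else 0)" .
  qed simp
  also have "\<dots> = 2 * card {e \<in> E. e \<subseteq> T} + card (edge_cut E T)"
  proof -
    have "E \<inter> edge_cut E T = edge_cut E T" unfolding edge_cut_def by blast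
    then show ?thesis using finE by (simp add: sum.distrib sum.If_cases Int_def)
  qed
  finally show ?thesis .
qed

subsection \<open>Extending the matching\<close>

lemma perfect_matching_Un:
  assumes "perfect_matching X E M" "perfect_matching Y E N" "X \<inter> Y = {}"
  shows "perfect_matching (X \<union> Y) E (M \<union> N)"
proof -
  have "disjnt a b" if "a \<in> M" "b \<in> N" for a b
    using assms that unfolding perfect_matching_def disjnt_def by blast
  then have "pairwise disjnt (M \<union> N)"
    using assms(1,2) disjnt_sym unfolding perfect_matching_def graph_matching_def pairwise_def
    by (metis Un_iff)
  then show ?thesis
    using assms(1,2) unfolding perfect_matching_def graph_matching_def by blast
qed

text \<open>Used to charge edge-disjoint ears to a limited supply \<open>B\<close> of edges.\<close>

lemma mult_card_le_of_disjoint_traces: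
  assumes "finite P" "finite B" "pairwise (\<lambda>p q. disjnt (f p) (f q)) P"
    and "\<And>p. p \<in> P \<Longrightarrow> n \<le> card (f p \<inter> B)"
  shows "n * card P \<le> card B"
proof -
  have "n * card P = (\<Sum>p\<in>P. n)" by simp
  also have "\<dots> \<le> (\<Sum>p\<in>P. card (f p \<inter> B))" by (rule sum_mono) (rule assms(4))
  also have "\<dots> = card (\<Union>p\<in>P. f p \<inter> B)"
  proof (rule card_UN_disjoint[symmetric])
    show "\<forall>p\<in>P. \<forall>q\<in>P. p \<noteq> q \<longrightarrow> f p \<inter> B \<inter> (f q \<inter> B) = {}"
      using assms(3) unfolding pairwise_def disjnt_def by blast
  qed (use assms(1,2) in auto)
  also have "\<dots> \<le> card B" using assms(2) by (intro card_mono) auto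
  finally show ?thesis .
qed

theorem theorem6:
  fixes V :: "'a set" and E M :: "'a set set" and m r :: nat
  assumes "2 \<le> m" and "m \<le> r - 1"
    and "regular_graph r V E"
    and "even (card V)"
    and "cyclic_edge_connectivity V E \<ge> enat (m * r - m + 1)"
    and "graph_matching E M" and "card M = m"
    and "\<exists>P. (\<forall>p\<in>P. odd_ear V E (\<Union>M) p)
           \<and> pairwise (\<lambda>p q. disjnt (walk_edges p) (walk_edges q)) P
           \<and> int (card P) = int m * int r - \<lceil>real r / 2\<rceil> + 1"
  shows "extends_to_perfect_matching V E M"
proof (rule ccontr)
  assume noext: "\<not> extends_to_perfect_matching V E M"
  have finV: "finite V" and E: "\<And>e. e \<in> E \<Longrightarrow> e \<subseteq> V \<and> card e = 2"
    and deg: "\<And>v. v \<in> V \<Longrightarrow> card {e \<in> E. v \<in> e} = r"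
    using assms(3) unfolding regular_graph_def simple_graph_def by auto
  have finE: "finite E" by (rule finite_subset[of _ "Pow V"]) (use E finV in auto)
  have edge: "\<exists>a b. e = {a, b} \<and> a \<noteq> b" if "e \<in> E" for e
    using E[OF that] by (meson card_2_iff)
  define U where "U = \<Union>M"
  have ME: "M \<subseteq> E" and disjM: "pairwise disjnt M" using assms(6) unfolding graph_matching_def by auto
  have UV: "U \<subseteq> V" unfolding U_def using ME E by blast
  have finU: "finite U" by (rule finite_subset[OF UV finV])
  have "card U = (\<Sum>e\<in>M. card e)"
    unfolding U_def using disjM ME E finV
    by (intro card_Union_disjoint) (auto intro: finite_subset)
  also have "\<dots> = (\<Sum>e\<in>M. 2)" using ME E by (intro sum.cong) auto
  finally have cardU: "card U = 2 * m" using assms(7) by simp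
  have pmU: "perfect_matching U E M" using assms(6) unfolding perfect_matching_def U_def by blast

  \<comment> \<open>A barrier in the graph without \<open>U\<close>\<close>
  have noPM: "\<nexists>N. perfect_matching (V - U) E N"
  proof
    assume "\<exists>N. perfect_matching (V - U) E N"
    then obtain N where "perfect_matching (V - U) E N" by blast
    then have "perfect_matching (U \<union> (V - U)) E (M \<union> N)" by (intro perfect_matching_Un[OF pmU]) auto
    moreover have "U \<union> (V - U) = V" using UV by blast
    ultimately show False using noext unfolding extends_to_perfect_matching_def by auto
  qed
  have "card (V - U) + card U = card V"
    using UV finV finU by (metis card_Diff_subset card_mono le_add_diff_inverse2)
  then have evW: "even (card (V - U))" using assms(4) cardU by (metis dvd_triv_left even_add)
  obtain S where SW: "S \<subseteq> V - U"
    and large: "card S + 2 \<le> card (comps E (V - U - S))"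
    and crit: "\<forall>C\<in>comps E (V - U - S). is_singleton C \<or>
      (\<forall>v\<in>C. \<exists>a\<in>C - {v}. \<exists>b\<in>C - {v}. a \<noteq> b \<and> {v, a} \<in> E \<and> {v, b} \<in> E)"
    using ex_critical_barrier[OF finite_Diff[OF finV] evW noPM] by auto
  define T where "T = S \<union> U"
  have TV: "T \<subseteq> V" and UT: "U \<subseteq> T" using SW UV unfolding T_def by auto
  have "finite S" using SW finV by (meson finite_Diff finite_subset)
  then have cardT: "card T = card S + 2 * m"
    unfolding T_def using SW finU cardU by (subst card_Un_disjoint) auto
  define K where "K = comps E (V - T)"
  have K: "K = comps E (V - U - S)" unfolding K_def T_def by (simp add: Un_commute set_diff_eq conj_ac)
  have finVT: "finite (V - T)" using finV by blast
  have finK: "finite K" unfolding K_def by (rule finite_comps[OF finVT])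

  \<comment> \<open>Edges between \<open>T\<close> and the components\<close>
  define K1 where "K1 = {C \<in> K. is_singleton C}"
  define K2 where "K2 = K - K1"
  have K12: "K = K1 \<union> K2" "K1 \<inter> K2 = {}" unfolding K1_def K2_def by auto
  have finK12: "finite K1" "finite K2" using finK K12(1) by auto
  have KV: "C \<subseteq> V - T" if "C \<in> K" for C using that comps_subset unfolding K_def by blast
  \<comment> \<open>A component has no edge to another one, so its boundary edges all end in
    \<open>T\<close>. Hence the boundaries are disjoint parts of the boundary of
    \<open>T\<close>.\<close>
  have cutE: "\<exists>a\<in>C. \<exists>b\<in>T. e = {a, b}" if C: "C \<in> K" and e: "e \<in> edge_cut E C" for C e
  proof -
    have eE: "e \<in> E" using e unfolding edge_cut_def by blast
    obtain a b where ab: "e = {a, b}" "a \<in> C" "b \<notin> C"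
      using edge[OF eE] e unfolding edge_cut_def by auto
    have "b \<in> T"
      using comps_no_edge[of C E "V - T" a b] C ab E[OF eE] eE unfolding K_def by auto
    then show ?thesis using ab by blast
  qed
  have "(\<Sum>C\<in>K. card (edge_cut E C)) = card (\<Union>C\<in>K. edge_cut E C)"
  proof (rule card_UN_disjoint[symmetric])
    show "finite K" by (rule finK)
    show "\<forall>C\<in>K. finite (edge_cut E C)" using finE unfolding edge_cut_def by simp
    show "\<forall>C\<in>K. \<forall>D\<in>K. C \<noteq> D \<longrightarrow> edge_cut E C \<inter> edge_cut E D = {}"
    proof (intro ballI impI equals0I)
      fix C D e assume CD: "C \<in> K" "D \<in> K" "C \<noteq> D" and "e \<in> edge_cut E C \<inter> edge_cut E D"
      then obtain a b a' b' where "a \<in> C" "b \<in> T" "e = {a, b}" "a' \<in> D" "b' \<in> T" "e = {a', b'}"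
        using cutE[of C e] cutE[of D e] by blast
      moreover have "C \<inter> D = {}" using comps_disjoint CD unfolding K_def by blast
      ultimately show False using KV[OF CD(1)] KV[OF CD(2)] by (auto simp: doubleton_eq_iff)
    qed
  qed
  also have "\<dots> \<le> card (edge_cut E T)"
  proof (rule card_mono)
    show "finite (edge_cut E T)" using finE unfolding edge_cut_def by simp
    show "(\<Union>C\<in>K. edge_cut E C) \<subseteq> edge_cut E T"
    proof
      fix e assume "e \<in> (\<Union>C\<in>K. edge_cut E C)"
      then obtain C where C: "C \<in> K" "e \<in> edge_cut E C" by blast
      then show "e \<in> edge_cut E T"
        using cutE[OF C] KV[OF C(1)] unfolding edge_cut_def by blast
    qed
  qed
  finally have "(\<Sum>C\<in>K. card (edge_cut E C)) \<le> card (edge_cut E T)" .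
  moreover have "(\<Sum>C\<in>K1. card (edge_cut E C)) = (\<Sum>C\<in>K1. r)"
  proof (rule sum.cong)
    fix C assume C: "C \<in> K1"
    then obtain v where v: "C = {v}" unfolding K1_def is_singleton_def by blast
    have "edge_cut E {v} = {e \<in> E. v \<in> e}"
      using edge unfolding edge_cut_def by fastforce
    then show "card (edge_cut E C) = r"
      using deg[of v] KV[of C] C v unfolding K1_def by auto
  qed simp
  ultimately have cuts: "r * card K1 + (\<Sum>C\<in>K2. card (edge_cut E C)) \<le> card (edge_cut E T)"
    using K12 finK12 by (simp add: sum.union_disjoint mult.commute)
  have hand: "r * (card S + 2 * m) = 2 * card {e \<in> E. e \<subseteq> T} + card (edge_cut E T)"
    using regular_graph_handshake[OF assms(3) TV] cardT by simp
  have "M \<subseteq> {e \<in> E. e \<subseteq> T}" using ME UT unfolding U_def by blast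
  \<comment> \<open>The \<open>m\<close> edges of \<open>M\<close> already lie inside
    \<open>T\<close>.\<close>
  then have eT: "m \<le> card {e \<in> E. e \<subseteq> T}"
    using card_mono[of "{e \<in> E. e \<subseteq> T}" M] finE assms(7) by simp
  have cardK: "card S + 2 \<le> card K1 + card K2"
    using large K12 finK12 K by (metis card_Un_disjoint)

  \<comment> \<open>At most one component with a cycle\<close>
  have cycle: "\<exists>c. is_cycle C E c" if C: "C \<in> K2" for C
  proof (rule ex_cycle_of_min_degree)
    have CK: "C \<in> K" using C unfolding K2_def by blast
    show "finite C" "C \<noteq> {}"
      using CK finite_comp[OF finVT] comps_nonempty unfolding K_def by blast+
    show "\<exists>a\<in>C - {v}. \<exists>b\<in>C - {v}. a \<noteq> b \<and> {v, a} \<in> E \<and> {v, b} \<in> E" if "v \<in> C" for v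
      using bspec[OF crit, of C] C that unfolding K2_def K1_def K by blast
  qed
  have few: "card K2 \<le> 1"
  proof (rule ccontr)
    assume "\<not> card K2 \<le> 1"
    then obtain l where l: "card K2 = l + 2" 
      by (metis add.commute le_iff_add not_less_eq_eq one_add_one plus_1_eq_Suc)
    \<comment> \<open>With \<open>q = r - 1\<close> the bound \<open>m * r - m + 1\<close> becomes
      \<open>m * q + 1\<close>. The count then reduces to
      \<open>l * (m * q + 1) + 2 \<le> l * r\<close>, which is false because
      \<open>r \<le> m * q + 1\<close>.\<close>
    obtain q where q: "r = q + 1" using assms(1,2) by (cases r) auto
    have "m * q + 1 \<le> card (edge_cut E C)" if C: "C \<in> K2" for C
    proof -
      have "\<not> K2 \<subseteq> {C}" using card_mono[of "{C}" K2] \<open>\<not> card K2 \<le> 1\<close> by auto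
      then obtain D where D: "D \<in> K2" "D \<noteq> C" by blast
      obtain c d where "is_cycle C E c" "is_cycle D E d" using cycle C D(1) by blast
      moreover have "C \<inter> D = {}" using comps_disjoint C D unfolding K2_def K_def by blast
      moreover have "C \<subseteq> V" "D \<subseteq> V" using KV C D(1) unfolding K2_def by blast+
      ultimately have "cyclic_edge_cut V E (edge_cut E C)" using cyclic_edge_cut_edge_cut by blast
      then have "cyclic_edge_connectivity V E \<le> enat (card (edge_cut E C))"
        unfolding cyclic_edge_connectivity_def by (intro INF_lower) simp
      then have "enat (m * r - m + 1) \<le> enat (card (edge_cut E C))" 
        using assms(5) by (rule order_trans[rotated])
      then show ?thesis using q by simp
    qed
    then have "(\<Sum>C\<in>K2. m * q + 1) \<le> (\<Sum>C\<in>K2. card (edge_cut E C))" by (rule sum_mono)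
    then have "r * card K1 + (l + 2) * (m * q + 1) + 2 * m \<le> r * (card S + 2 * m)"
      using cuts hand eT l by simp
    moreover have "r * card S \<le> r * (card K1 + l)" using cardK l by (intro mult_le_mono) auto
    moreover have "l * r \<le> l * (m * q + 1)" using q assms(1) by (intro mult_le_mono) auto
    moreover have "q * (2 * m) = 2 * (m * q)" "q * l = l * q" by simp_all
    ultimately show False
      unfolding q add_mult_distrib add_mult_distrib2 mult_1_left mult_1_right by linarith
  qed

  \<comment> \<open>The cyclic component if there is one, and empty otherwise, so both cases are
    treated together.\<close>
  define C0 where "C0 = \<Union>K2"
  have cutC0: "(\<Sum>C\<in>K2. card (edge_cut E C)) = card (edge_cut E C0)"
  proof (cases "K2 = {}")
    case True
    then show ?thesis unfolding C0_def edge_cut_def by simp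
  next
    case False
    then have "card K2 = 1" using few finK12(2) by (simp add: le_Suc_eq)
    then obtain C where "K2 = {C}" by (rule card_1_singletonE)
    then show ?thesis unfolding C0_def by simp
  qed

  \<comment> \<open>The contribution of the odd ears\<close>
  obtain P where ears: "\<And>p. p \<in> P \<Longrightarrow> odd_ear V E U p"
    and disj: "pairwise (\<lambda>p q. disjnt (walk_edges p) (walk_edges q)) P"
    and cardP: "int (card P) = int m * int r - \<lceil>real r / 2\<rceil> + 1"
    using assms(8) unfolding U_def by blast
  \<comment> \<open>Rounding up gives \<open>2 * \<lceil>real r / 2\<rceil> \<le> r + 1\<close>,
    which turns the number of ears into the strict inequality \<open>big\<close>.\<close>
  have "real_of_int \<lceil>real r / 2\<rceil> < real r / 2 + 1" by linarith
  then have "2 * \<lceil>real r / 2\<rceil> \<le> int r + 1" by linarith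
  then have "2 * (int m * int r) < 2 * int (card P) + int r" using cardP by linarith
  then have big: "2 * (m * r) < 2 * card P + r"
    by (metis (mono_tags, opaque_lifting) of_nat_add of_nat_less_iff of_nat_mult of_nat_numeral)
  have "r \<le> 2 * (m * r)" using assms(1) by simp
  \<comment> \<open>An infinite \<open>P\<close> would have \<open>card P = 0\<close>, contradicting
    \<open>big\<close>.\<close>
  then have finP: "finite P" using big by (cases "finite P") auto
  \<comment> \<open>Ears in \<open>PT\<close> use up edges inside \<open>T\<close>. Each of the
    others crosses the boundary of \<open>C0\<close> twice.\<close>
  define PT where "PT = {p \<in> P. \<exists>e\<in>walk_edges p. e \<subseteq> T}"
  have earE: "walk_edges p \<subseteq> E" if "p \<in> P" for p
    using odd_ear_trail[OF ears[OF that]] unfolding is_walk_def by metis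
  have "1 * card PT \<le> card {e \<in> E. e \<subseteq> T}"
  proof (rule mult_card_le_of_disjoint_traces[where f = walk_edges])
    show "finite PT" "finite {e \<in> E. e \<subseteq> T}" using finP finE unfolding PT_def by auto
    show "pairwise (\<lambda>p q. disjnt (walk_edges p) (walk_edges q)) PT"
      by (rule pairwise_subset[OF disj]) (auto simp: PT_def)
    show "1 \<le> card (walk_edges p \<inter> {e \<in> E. e \<subseteq> T})" if "p \<in> PT" for p
    proof -
      have "walk_edges p \<inter> {e \<in> E. e \<subseteq> T} \<noteq> {}" using that earE unfolding PT_def by blast
      then show ?thesis using finE by (simp add: Suc_le_eq card_gt_0_iff)
    qed
  qed
  moreover have "2 * card (P - PT) \<le> card (edge_cut E C0)"
  proof (rule mult_card_le_of_disjoint_traces[where f = walk_edges])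
    show "finite (P - PT)" using finP by blast
    show "finite (edge_cut E C0)" using finE unfolding edge_cut_def by simp
    show "pairwise (\<lambda>p q. disjnt (walk_edges p) (walk_edges q)) (P - PT)"
      by (rule pairwise_subset[OF disj]) auto
    show "2 \<le> card (walk_edges p \<inter> edge_cut E C0)" if p: "p \<in> P - PT" for p
    proof -
      obtain q where q: "is_walk V E q" "is_trail q" "walk_edges q = walk_edges p"
        "hd q \<in> U" "last q \<in> U" "even (length q)"
        using odd_ear_trail[of V E U p] ears p by blast
      have "2 \<le> card (walk_edges q \<inter> edge_cut E C0)"
      proof (rule odd_trail_crosses_edge_cut[OF q(1,2)])
        show "hd q \<in> T" "last q \<in> T" "even (length q)" using q UT by auto
        have "V - T = \<Union>K" unfolding K_def using Union_comps[OF finVT] by blast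
        then show "V \<subseteq> T \<union> \<Union>K1 \<union> C0" unfolding C0_def using K12(1) by blast
        show "T \<inter> C0 = {}" using KV unfolding C0_def K2_def by blast
        show "\<not> e \<subseteq> T" if "e \<in> walk_edges q" for e
          using p that q(3) unfolding PT_def by blast
        show "{a, b} \<notin> E" if a: "a \<in> \<Union>K1" and b: "b \<notin> T" for a b
        proof
          assume ab: "{a, b} \<in> E"
          then have "a \<noteq> b" "b \<in> V" using E[OF ab] by auto
          obtain C where "C \<in> K" "C = {a}"
            using a unfolding K1_def is_singleton_def by blast
          then show False
            using comps_no_edge[of C E "V - T" a b] ab \<open>a \<noteq> b\<close> \<open>b \<in> V\<close> b
            unfolding K_def by auto
        qed
      qed
      then show ?thesis using q(3) by simp
    qed
  qed
  moreover have "card P = card PT + card (P - PT)"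
    using finP card_Un_disjoint[of PT "P - PT"] unfolding PT_def
    by (metis (no_types, lifting) Diff_disjoint Diff_partition finite_Diff finite_subset mem_Collect_eq subsetI)
  \<comment> \<open>At most one of the \<open>card S + 2\<close> or more components is cyclic, so at
    least \<open>card S + 1\<close> are singletons.\<close>
  moreover have "r * (card S + 1) \<le> r * card K1" using cardK few by (intro mult_le_mono) auto
  \<comment> \<open>Each ear, of either kind, costs two in the count: an edge inside
    \<open>T\<close> has weight two in \<open>hand\<close>, and a crossing ear takes two boundary
    edges. The terms \<open>r * card S\<close> cancel.\<close>
  ultimately have "r + 2 * card P \<le> 2 * (m * r)"
    using cuts hand unfolding cutC0 by (simp add: algebra_simps)
  then show False using big by simp
qed

end
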